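(* Let $M$ be a $p\times q$ integer matrix with $p\ge 2$ such that no difference of two distinct rows of $M$ is parallel to the all-ones row vector $\mathbf{1}^T$. Define \[ r(M) = \min\left\{\frac{\max_i (Mw)_i - \min_i (Mw)_i}{\gcd_{i<j}\big((Mw)_i-(Mw)_j\big)} \;:\; w\in \mathbb{Z}^q,\ \sum_i w_i = 0,\ (Mw)_i \neq (Mw)_j \text{ for all } i\neq j\right\} + 1. \] Then for every $n\in\mathbb{N}$, with $r=r(M)$, \[ \left(2 - O\!\left(\frac{\log\log n}{\log n}\right)\right)\frac{n}{\log_p n} \le m(M,n) \le \left(2 + O\!\left(\frac{\log\log n}{\log n}\right)\right)\frac{n}{\log_r n}. \]
   Context: For a $p\times q$ integer matrix $M$ and $n\in\mathbb{N}$, $m(M,n)$ is the minimum cardinality of a subset $S\subseteq[q]^n$ such that the map $M_S\colon [p]^n\to\mathbb{Z}^S$, defined by $(M_S(i_1,\dots,i_n))_s = M_{i_1,s_1}+\dots+M_{i_n,s_n}$ for $(i_1,\dots,i_n)\in[p]^n$ and $s=(s_1,\dots,s_n)\in S$, is injective. The $O(\cdot)$ terms are as $n\to\infty$ with $M$ fixed. *)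

theory Defs
  imports Complex_Main "HOL-Library.FuncSet" "HOL-Library.Landau_Symbols" "Jordan_Normal_Form.Matrix"
begin

text \<open>Indices are 0-based: \<open>[p]\<close> is rendered as \<open>{..<p}\<close>, and \<open>[p]\<^sup>n\<close> as the extensional functions
  from \<open>{..<n}\<close> to \<open>{..<p}\<close>.\<close>

definition tuples :: "nat \<Rightarrow> nat \<Rightarrow> (nat \<Rightarrow> nat) set" where
  "tuples p n = {..<n} \<rightarrow>\<^sub>E {..<p}"

definition tuple_map :: "int mat \<Rightarrow> nat \<Rightarrow> (nat \<Rightarrow> nat) set \<Rightarrow> (nat \<Rightarrow> nat) \<Rightarrow> (nat \<Rightarrow> nat) \<Rightarrow> int" where
  "tuple_map M n S i = (\<lambda>s\<in>S. \<Sum>k<n. M $$ (i k, s k))"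

definition detecting :: "int mat \<Rightarrow> nat \<Rightarrow> (nat \<Rightarrow> nat) set \<Rightarrow> bool" where
  "detecting M n S \<longleftrightarrow>
     S \<subseteq> tuples (dim_col M) n \<and> inj_on (tuple_map M n S) (tuples (dim_row M) n)"

definition min_detecting :: "int mat \<Rightarrow> nat \<Rightarrow> nat" where
  "min_detecting M n = (LEAST c. \<exists>S. detecting M n S \<and> card S = c)"

text \<open>The scalar may be 0, so the zero vector is parallel to the all-ones vector.\<close>

definition parallel_to_ones :: "int vec \<Rightarrow> bool" where
  "parallel_to_ones v \<longleftrightarrow>
     (\<exists>c :: real. map_vec real_of_int v = c \<cdot>\<^sub>v vec (dim_vec v) (\<lambda>_. 1))"

definition separating_weights :: "int mat \<Rightarrow> int vec set" where
  "separating_weights M =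
     {w \<in> carrier_vec (dim_col M).
        (\<Sum>k<dim_col M. w $ k) = 0 \<and>
        (\<forall>i<dim_row M. \<forall>j<dim_row M. i \<noteq> j \<longrightarrow> (M *\<^sub>v w) $ i \<noteq> (M *\<^sub>v w) $ j)}"

definition spread_ratio :: "int mat \<Rightarrow> int vec \<Rightarrow> real" where
  "spread_ratio M w =
     real_of_int (Max {(M *\<^sub>v w) $ i | i. i < dim_row M} - Min {(M *\<^sub>v w) $ i | i. i < dim_row M}) /
     real_of_int (Gcd {(M *\<^sub>v w) $ i - (M *\<^sub>v w) $ j | i j. i < j \<and> j < dim_row M})"

text \<open>For \<open>w \<in> separating_weights M\<close> and at least two rows, \<open>spread_ratio M w\<close> is a positive integer,
  since the gcd is nonzero and divides every difference. Hence the minimum below is attained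
  as soon as \<open>separating_weights M\<close> is nonempty.\<close>

definition r_value :: "int mat \<Rightarrow> real" where
  "r_value M = (LEAST x. \<exists>w\<in>separating_weights M. x = spread_ratio M w) + 1"

end

theory Submission
  imports Defs "HOL-Real_Asymp.Real_Asymp"
begin

text \<open>The upper bound generalises Lindstroem's detecting matrices. Queries are indexed by a down-set \<open>D\<close>
  of finite sets, and each \<open>a \<in> D\<close> is assigned about \<open>card a * log R 2\<close> of the \<open>n\<close> coordinates.
  The \<open>j\<close>-th of these looks only at \<open>x \<inter> a\<close>, in such a way that its alternating sum over \<open>Pow a\<close>
  is \<open>R ^ j\<close> times the optimal weight vector, so that the coordinates appear as the base-\<open>R\<close> digits of
  an integer. Taking for \<open>D\<close> of the order of \<open>ln n\<close> copies of one power set, rather than a single power set,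
  reaches every \<open>n\<close> without losing a constant factor. The lower bound compares the \<open>p ^ n\<close>
  distinct values of the map, whose components have variance of order \<open>n\<close>, with the number of
  lattice points available at scale \<open>\<surd>n\<close> in dimension \<open>card S\<close>.\<close>

section \<open>Uniqueness of digits and alternating sums over power sets\<close>

text \<open>Take the nonzero digit of least exponent: all other terms are divisible by one more
  power of \<open>b\<close>, so \<open>b\<close> divides this digit, which is too small for that.
  Digits may be negative, so differences of two expansions are covered.\<close>

lemma power_digits_unique:
  fixes b :: nat and c :: "'a \<Rightarrow> int"
  assumes "finite K" and "inj_on e K" and small: "\<And>k. k \<in> K \<Longrightarrow> \<bar>c k\<bar> < int b"
    and zero: "(\<Sum>k\<in>K. int b ^ e k * c k) = 0" and "k \<in> K"
  shows "c k = 0"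
proof (rule ccontr)
  assume "c k \<noteq> 0"
  then obtain l where l: "l \<in> K" "c l \<noteq> 0"
    and least: "\<And>i. i \<in> K \<Longrightarrow> c i \<noteq> 0 \<Longrightarrow> e l \<le> e i"
    using ex_has_least_nat[of "\<lambda>i. i \<in> K \<and> c i \<noteq> 0" k e] \<open>k \<in> K\<close> by blast
  have "int b ^ Suc (e l) dvd int b ^ e i * c i" if "i \<in> K - {l}" for i
  proof (cases "c i = 0")
    case False
    then have "e l \<le> e i" "e l \<noteq> e i"
      using that least l inj_onD[OF assms(2)] by blast+
    then show ?thesis
      by (simp add: dvd_mult2 le_imp_power_dvd del: power_Suc)
  qed simp
  then have "int b ^ Suc (e l) dvd (\<Sum>i\<in>K - {l}. int b ^ e i * c i)"
    by (rule dvd_sum)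
  moreover have "int b ^ e l * c l = - (\<Sum>i\<in>K - {l}. int b ^ e i * c i)"
    using zero sum.remove[OF \<open>finite K\<close> \<open>l \<in> K\<close>, of "\<lambda>i. int b ^ e i * c i"] by simp
  ultimately have dvd: "int b ^ e l * int b dvd int b ^ e l * c l"
    by (metis dvd_minus_iff power_Suc2)
  have "b > 0" using small[OF l(1)] by linarith
  with dvd have "int b dvd c l" by simp
  then show False
    using small[OF l(1)] dvd_imp_le_int[OF l(2)] by fastforce
qed

lemma alternating_sum_Pow_insert:
  fixes F :: "'a set \<Rightarrow> 'b::comm_ring_1"
  assumes "finite a" and "e \<notin> a"
  shows "(\<Sum>x\<in>Pow (insert e a). (-1) ^ card x * F x)
    = (\<Sum>x\<in>Pow a. (-1) ^ card x * (F x - F (insert e x)))"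
proof -
  have "(\<Sum>x\<in>Pow (insert e a). (-1) ^ card x * F x)
    = (\<Sum>x\<in>Pow a. (-1) ^ card x * F x) + (\<Sum>x\<in>insert e ` Pow a. (-1) ^ card x * F x)"
    unfolding Pow_insert using assms by (intro sum.union_disjoint) auto
  also have "(\<Sum>x\<in>insert e ` Pow a. (-1) ^ card x * F x)
    = (\<Sum>x\<in>Pow a. (-1) ^ card (insert e x) * F (insert e x))"
    using assms by (subst sum.reindex) (auto intro!: inj_onI simp: insert_ident)
  also have "\<dots> = (\<Sum>x\<in>Pow a. - ((-1) ^ card x * F (insert e x)))"
  proof (intro sum.cong refl)
    fix x assume "x \<in> Pow a"
    then have "finite x" "e \<notin> x" using assms finite_subset by auto
    then show "(-1) ^ card (insert e x) * F (insert e x) = - ((-1) ^ card x * F (insert e x))"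
      by simp
  qed
  finally show ?thesis
    by (simp add: sum.distrib[symmetric] right_diff_distrib)
qed

text \<open>The subsets \<open>x\<close> without \<open>e\<close> and their partners
  \<open>insert e x\<close> carry opposite signs and cancel. In the decoding, \<open>e\<close> is a
  point missing from a block.\<close>

lemma alternating_sum_Pow_eq_0:
  fixes F :: "'a set \<Rightarrow> 'b::comm_ring_1"
  assumes "finite a" and "e \<in> a" and "\<And>x. F (insert e x) = F x"
  shows "(\<Sum>x\<in>Pow a. (-1) ^ card x * F x) = 0"
  using alternating_sum_Pow_insert[of "a - {e}" e F] assms by (simp add: insert_absorb)

lemma sum_Pow_parity:
  assumes "finite a"
  shows "sum F (Pow a) = sum F {x \<in> Pow a. even (card x)} + sum F {x \<in> Pow a. odd (card x)}"
  using assms by (subst sum.union_disjoint[symmetric]) (auto intro!: arg_cong[of _ _ "sum F"])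

text \<open>The alternating sum of the constant 1 vanishes. The two counts are the room available
  for the positive and the negative part of a weight vector.\<close>

lemma card_even_odd_subsets:
  assumes "finite a" and "a \<noteq> {}"
  shows "card {x \<in> Pow a. even (card x)} = 2 ^ (card a - 1)"
    and "card {x \<in> Pow a. odd (card x)} = 2 ^ (card a - 1)"
proof -
  let ?E = "{x \<in> Pow a. even (card x)}" and ?O = "{x \<in> Pow a. odd (card x)}"
  have un: "?E \<union> ?O = Pow a" "?E \<inter> ?O = {}" and fin: "finite ?E" "finite ?O"
    using assms by auto
  obtain e where "e \<in> a" using assms by blast
  have "(\<Sum>x\<in>Pow a. (-1) ^ card x * (1::int)) = 0"
    using alternating_sum_Pow_eq_0[OF \<open>finite a\<close> \<open>e \<in> a\<close>, of "\<lambda>_. 1"] by simp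
  also have "(\<Sum>x\<in>Pow a. (-1) ^ card x * (1::int))
      = (\<Sum>x\<in>?E. (-1) ^ card x * 1) + (\<Sum>x\<in>?O. (-1) ^ card x * 1)"
    by (rule sum_Pow_parity[OF \<open>finite a\<close>])
  also have "\<dots> = int (card ?E) - int (card ?O)"
    by simp
  finally have "card ?E = card ?O" by simp
  moreover have "card ?E + card ?O = 2 ^ card a"
    using card_Un_disjoint[OF fin un(2)] un(1) card_Pow[OF \<open>finite a\<close>] by simp
  moreover have "2 ^ card a = 2 * (2::nat) ^ (card a - 1)"
    using assms by (metis One_nat_def Suc_pred card_gt_0_iff power_Suc)
  ultimately show "card ?E = 2 ^ (card a - 1)" "card ?O = 2 ^ (card a - 1)"
    by auto
qed

section \<open>Queries that realise a weight vector, and their decoding\<close>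

text \<open>A bijection from \<open>E\<close> onto the disjoint union of the sets
  \<open>{..<v c}\<close> yields a map whose fibre over \<open>c\<close> has \<open>v c\<close>
  elements; sums against an arbitrary \<open>G\<close> are the form in which this is used.\<close>

lemma exists_map_with_fibre_sizes:
  fixes v :: "nat \<Rightarrow> nat"
  assumes "finite E" and "(\<Sum>c<q. v c) = card E"
  obtains f where "\<And>x. x \<in> E \<Longrightarrow> f x < q"
    and "\<And>G :: nat \<Rightarrow> int. (\<Sum>x\<in>E. G (f x)) = (\<Sum>c<q. int (v c) * G c)"
proof -
  let ?S = "SIGMA c:{..<q}. {..<v c}"
  have "card E = card ?S" using assms by simp
  then obtain h where h: "bij_betw h E ?S"
    using finite_same_card_bij[OF \<open>finite E\<close>, of ?S] by auto
  have "(\<Sum>x\<in>E. G (fst (h x))) = (\<Sum>c<q. int (v c) * G c)" for G :: "nat \<Rightarrow> int"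
  proof -
    have "(\<Sum>x\<in>E. G (fst (h x))) = (\<Sum>y\<in>?S. G (fst y))"
      by (rule sum.reindex_bij_betw[OF h])
    also have "\<dots> = (\<Sum>c<q. \<Sum>j<v c. G c)"
      by (subst sum.Sigma) (auto simp: case_prod_beta)
    finally show ?thesis by simp
  qed
  moreover have "fst (h x) < q" if "x \<in> E" for x
    using bij_betw_apply[OF h that] by auto
  ultimately show ?thesis
    using that[of "\<lambda>x. fst (h x)"] by simp
qed

text \<open>Even subsets take the value \<open>c\<close> as often as the positive part of
  \<open>u c\<close> says, odd subsets as often as the negative part. Both totals agree because
  \<open>u\<close> sums to 0; leftover subsets of either parity are sent to 0 and cancel.\<close>

lemma exists_map_with_alternating_sum:
  fixes u :: "nat \<Rightarrow> int"
  assumes "finite a" and "a \<noteq> {}" and "q > 0" and zero: "(\<Sum>c<q. u c) = 0"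
    and small: "(\<Sum>c<q. max (u c) 0) \<le> 2 ^ (card a - 1)"
  obtains f where "\<And>x. x \<in> Pow a \<Longrightarrow> f x < q"
    and "\<And>G :: nat \<Rightarrow> int. (\<Sum>x\<in>Pow a. (-1) ^ card x * G (f x)) = (\<Sum>c<q. u c * G c)"
proof -
  let ?E = "{x \<in> Pow a. even (card x)}" and ?O = "{x \<in> Pow a. odd (card x)}"
  have fin: "finite ?E" "finite ?O"
    using assms by auto
  \<comment> \<open>The number of leftover subsets, the same for both parities.\<close>
  define k where "k = 2 ^ (card a - 1) - (\<Sum>c<q. max (u c) 0)"
  have k: "k \<ge> 0" using small by (simp add: k_def)
  define v where "v s c = nat (max (s * u c) 0 + (if c = 0 then k else 0))" for s c
  have int_v: "int (v s c) = max (s * u c) 0 + (if c = 0 then k else 0)" for s c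
    using k by (simp add: v_def)
  have neg: "(\<Sum>c<q. max (- u c) 0) = (\<Sum>c<q. max (u c) 0)"
  proof -
    have "(\<Sum>c<q. max (u c) 0) - (\<Sum>c<q. max (- u c) 0) = (\<Sum>c<q. u c)"
      unfolding sum_subtractf[symmetric] by (intro sum.cong) auto
    then show ?thesis using zero by simp
  qed
  have "int (\<Sum>c<q. v s c) = (\<Sum>c<q. max (s * u c) 0) + k" for s
    using \<open>q > 0\<close> by (simp add: int_v sum.distrib)
  then have "int (\<Sum>c<q. v 1 c) = int (2 ^ (card a - 1))"
    "int (\<Sum>c<q. v (-1) c) = int (2 ^ (card a - 1))"
    using neg by (simp_all add: k_def)
  then have eq: "(\<Sum>c<q. v 1 c) = card ?E" "(\<Sum>c<q. v (-1) c) = card ?O"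
    unfolding card_even_odd_subsets[OF assms(1,2)] of_nat_eq_iff .
  obtain f where f: "\<And>x. x \<in> ?E \<Longrightarrow> f x < q"
    "\<And>G :: nat \<Rightarrow> int. (\<Sum>x\<in>?E. G (f x)) = (\<Sum>c<q. int (v 1 c) * G c)"
    by (rule exists_map_with_fibre_sizes[OF fin(1) eq(1)]) (rule that)
  obtain g where g: "\<And>x. x \<in> ?O \<Longrightarrow> g x < q"
    "\<And>G :: nat \<Rightarrow> int. (\<Sum>x\<in>?O. G (g x)) = (\<Sum>c<q. int (v (-1) c) * G c)"
    by (rule exists_map_with_fibre_sizes[OF fin(2) eq(2)]) (rule that)
  define F where "F x = (if even (card x) then f x else g x)" for x
  have v_diff: "int (v 1 c) - int (v (-1) c) = u c" for c
    by (cases "u c \<ge> 0") (auto simp: int_v)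
  have "(\<Sum>x\<in>Pow a. (-1) ^ card x * G (F x)) = (\<Sum>c<q. u c * G c)" for G :: "nat \<Rightarrow> int"
  proof -
    have "(\<Sum>x\<in>Pow a. (-1) ^ card x * G (F x))
      = (\<Sum>x\<in>?E. (-1) ^ card x * G (F x)) + (\<Sum>x\<in>?O. (-1) ^ card x * G (F x))"
      by (rule sum_Pow_parity[OF \<open>finite a\<close>])
    also have "\<dots> = (\<Sum>x\<in>?E. G (f x)) - (\<Sum>x\<in>?O. G (g x))"
      by (simp add: F_def sum_negf)
    also have "\<dots> = (\<Sum>c<q. (int (v 1 c) - int (v (-1) c)) * G c)"
      unfolding f(2) g(2) by (simp add: sum_subtractf left_diff_distrib)
    finally show ?thesis
      unfolding v_diff .
  qed
  moreover have "F x < q" if "x \<in> Pow a" for x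
    using that f(1) g(1) by (cases "even (card x)") (auto simp: F_def)
  ultimately show ?thesis by (rule that[of F, rotated])
qed

text \<open>Moebius inversion on the down-set \<open>D\<close>: the alternating sum over \<open>Pow a\<close> kills every
  coordinate whose block does not contain \<open>a\<close>, so the blocks are decoded from the largest sets
  down, each one by uniqueness of base-\<open>R\<close> digits.\<close>

lemma down_set_decoding:
  fixes A :: "nat \<Rightarrow> nat \<Rightarrow> int" and B :: "nat \<Rightarrow> 'a set" and e :: "nat \<Rightarrow> nat"
  assumes fin: "\<And>a. a \<in> D \<Longrightarrow> finite a" and "finite D"
    and down: "\<And>a x. a \<in> D \<Longrightarrow> x \<subseteq> a \<Longrightarrow> x \<in> D"
    and B: "\<And>k. k < n \<Longrightarrow> B k \<in> D"
    and inj: "inj_on (\<lambda>k. (B k, e k)) {..<n}"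
    and f: "\<And>k G. k < n \<Longrightarrow> (\<Sum>x\<in>Pow (B k). (-1) ^ card x * G (f k x)) = (\<Sum>c<q. int R ^ e k * w c * (G c :: int))"
    and \<alpha>: "\<And>i. i < p \<Longrightarrow> (\<Sum>c<q. w c * A i c) = lo + d * \<alpha> i"
    and "d \<noteq> 0" and inj\<alpha>: "inj_on \<alpha> {..<p}" and range\<alpha>: "\<And>i. i < p \<Longrightarrow> 0 \<le> \<alpha> i \<and> \<alpha> i < int R"
    and y: "\<And>k. k < n \<Longrightarrow> y k < p" and z: "\<And>k. k < n \<Longrightarrow> z k < p"
    and eq: "\<And>x. x \<in> D \<Longrightarrow> (\<Sum>k<n. A (y k) (f k (x \<inter> B k))) = (\<Sum>k<n. A (z k) (f k (x \<inter> B k)))"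
    and "k < n"
  shows "y k = z k"
proof -
  have "y k = z k" if "k < n" "B k = a" for a k
    using that
  proof (induction "card (\<Union>D) - card a" arbitrary: a k rule: less_induct)
    case less
    have finU: "finite (\<Union>D)" using fin \<open>finite D\<close> by blast
    have a: "a \<in> D" "finite a" using less.prems B fin by auto
    have bigger: "y l = z l" if "l < n" "a \<subset> B l" for l
    proof -
      have "B l \<subseteq> \<Union>D" "B l \<in> D" using B[OF \<open>l < n\<close>] by auto
      then have "card a < card (B l)" "card (B l) \<le> card (\<Union>D)"
        using that fin finU by (auto intro: psubset_card_mono card_mono)
      then show ?thesis using less.hyps[of "B l" l] that by simp
    qed
    \<comment> \<open>The contribution of coordinate \<open>l\<close> to the alternating sum of the
      differences between the two answers.\<close>
    define T where "T l = (\<Sum>x\<in>Pow a. (-1) ^ card x *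
      (A (y l) (f l (x \<inter> B l)) - A (z l) (f l (x \<inter> B l))))" for l
    have "(\<Sum>l<n. T l) = (\<Sum>x\<in>Pow a. (-1) ^ card x *
      ((\<Sum>l<n. A (y l) (f l (x \<inter> B l))) - (\<Sum>l<n. A (z l) (f l (x \<inter> B l)))))"
      unfolding T_def by (subst sum.swap) (simp add: sum_distrib_left sum_subtractf[symmetric])
    also have "\<dots> = 0"
      using eq down[OF a(1)] by (intro sum.neutral) auto
    finally have "(\<Sum>l<n. T l) = 0" .
    \<comment> \<open>Blocks strictly above \<open>a\<close> are decoded already; a block that
      misses a point \<open>t\<close> of \<open>a\<close> does not notice whether \<open>t\<close>
      is in \<open>x\<close>.\<close>
    moreover have "T l = 0" if l: "l < n" "B l \<noteq> a" for l
    proof (cases "a \<subseteq> B l")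
      case True
      then show ?thesis using bigger[of l] l by (auto simp: T_def)
    next
      case False
      then obtain t where "t \<in> a" "t \<notin> B l" by blast
      then show ?thesis
        unfolding T_def by (intro alternating_sum_Pow_eq_0[OF a(2)]) auto
    qed
    ultimately have "(\<Sum>l\<in>{l. l < n \<and> B l = a}. T l) = 0"
      by (subst sum.mono_neutral_left[of "{..<n}"]) auto
    \<comment> \<open>On the blocks equal to \<open>a\<close> the offset \<open>lo\<close> cancels
      and \<open>d\<close> factors out, leaving a base-\<open>R\<close> expansion of 0 with digits
      \<open>\<alpha> (y l) - \<alpha> (z l)\<close>.\<close>
    moreover have "T l = d * (int R ^ e l * (\<alpha> (y l) - \<alpha> (z l)))" if l: "l < n" "B l = a" for l
    proof -
      have "T l = (\<Sum>x\<in>Pow (B l). (-1) ^ card x * (A (y l) (f l x) - A (z l) (f l x)))"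
        unfolding T_def l(2) by (intro sum.cong refl) (simp add: Int_absorb2)
      also have "\<dots> = (\<Sum>c<q. int R ^ e l * w c * (A (y l) c - A (z l) c))"
        by (rule f[OF l(1), of "\<lambda>c. A (y l) c - A (z l) c"])
      also have "\<dots> = int R ^ e l * ((\<Sum>c<q. w c * A (y l) c) - (\<Sum>c<q. w c * A (z l) c))"
        unfolding sum_subtractf[symmetric] sum_distrib_left
        by (intro sum.cong refl) (simp add: algebra_simps)
      also have "\<dots> = d * (int R ^ e l * (\<alpha> (y l) - \<alpha> (z l)))"
        using \<alpha>[OF y[OF l(1)]] \<alpha>[OF z[OF l(1)]] by (simp add: algebra_simps)
      finally show ?thesis .
    qed
    ultimately have "d * (\<Sum>l\<in>{l. l < n \<and> B l = a}. int R ^ e l * (\<alpha> (y l) - \<alpha> (z l))) = 0"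
      by (simp add: sum_distrib_left)
    then have "(\<Sum>l\<in>{l. l < n \<and> B l = a}. int R ^ e l * (\<alpha> (y l) - \<alpha> (z l))) = 0"
      using \<open>d \<noteq> 0\<close> by simp
    moreover have "\<bar>\<alpha> (y l) - \<alpha> (z l)\<bar> < int R" if "l < n" for l
      using range\<alpha>[OF y[OF that]] range\<alpha>[OF z[OF that]] by linarith
    moreover have "inj_on e {l. l < n \<and> B l = a}"
      using inj by (auto simp: inj_on_def)
    ultimately have "\<alpha> (y k) - \<alpha> (z k) = 0"
      using less.prems by (intro power_digits_unique[of "{l. l < n \<and> B l = a}" e]) auto
    then show ?case
      using inj\<alpha> y[OF less.prems(1)] z[OF less.prems(1)] by (auto dest: inj_onD)
  qed
  then show ?thesis using \<open>k < n\<close> by blast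
qed

text \<open>Each \<open>x\<close> in \<open>D\<close> gives one query, which shows coordinate
  \<open>k\<close> only the trace \<open>x \<inter> B k\<close>. The assumption \<open>small\<close>
  says that the scaled weights \<open>R ^ e k * w\<close> fit into the subsets of one parity of
  \<open>B k\<close>.\<close>

lemma detecting_of_down_set:
  fixes M :: "int mat" and B :: "nat \<Rightarrow> 'a set" and e :: "nat \<Rightarrow> nat"
  assumes M: "M \<in> carrier_mat p q" and "q > 0"
    and fin: "\<And>a. a \<in> D \<Longrightarrow> finite a" and "finite D"
    and down: "\<And>a x. a \<in> D \<Longrightarrow> x \<subseteq> a \<Longrightarrow> x \<in> D"
    and B: "\<And>k. k < n \<Longrightarrow> B k \<in> D - {{}}"
    and inj: "inj_on (\<lambda>k. (B k, e k)) {..<n}"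
    and zero: "(\<Sum>c<q. w c) = 0"
    and small: "\<And>k. k < n \<Longrightarrow> int R ^ e k * (\<Sum>c<q. max (w c) 0) \<le> 2 ^ (card (B k) - 1)"
    and \<alpha>: "\<And>i. i < p \<Longrightarrow> (\<Sum>c<q. w c * M $$ (i, c)) = lo + d * \<alpha> i"
    and "d \<noteq> 0" and inj\<alpha>: "inj_on \<alpha> {..<p}" and range\<alpha>: "\<And>i. i < p \<Longrightarrow> 0 \<le> \<alpha> i \<and> \<alpha> i < int R"
  shows "\<exists>S. detecting M n S \<and> card S \<le> card D"
proof -
  have "\<exists>f. (\<forall>x\<in>Pow (B k). f x < q) \<and>
    (\<forall>G :: nat \<Rightarrow> int. (\<Sum>x\<in>Pow (B k). (-1) ^ card x * G (f x)) = (\<Sum>c<q. int R ^ e k * w c * G c))"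
    if k: "k < n" for k
  proof -
    have "(\<Sum>c<q. max (int R ^ e k * w c) 0) = int R ^ e k * (\<Sum>c<q. max (w c) 0)"
      unfolding sum_distrib_left by (intro sum.cong refl) (simp add: max_mult_distrib_left)
    then have le: "(\<Sum>c<q. max (int R ^ e k * w c) 0) \<le> 2 ^ (card (B k) - 1)"
      using small[OF k] by simp
    have "(\<Sum>c<q. int R ^ e k * w c) = 0"
      using zero by (simp add: sum_distrib_left[symmetric])
    moreover have "finite (B k)" "B k \<noteq> {}" using B[OF k] fin by auto
    ultimately show ?thesis
      using le \<open>q > 0\<close> by (elim exists_map_with_alternating_sum[rotated 3]) blast+
  qed
  then obtain f where f_less: "\<And>k x. k < n \<Longrightarrow> x \<subseteq> B k \<Longrightarrow> f k x < q"
    and f: "\<And>k (G :: nat \<Rightarrow> int). k < n \<Longrightarrow>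
      (\<Sum>x\<in>Pow (B k). (-1) ^ card x * G (f k x)) = (\<Sum>c<q. int R ^ e k * w c * G c)"
    by (metis Pow_iff)
  define s where "s x = (\<lambda>k\<in>{..<n}. f k (x \<inter> B k))" for x
  have dims: "dim_row M = p" "dim_col M = q" using M by auto
  have "detecting M n (s ` D)"
    unfolding detecting_def dims
  proof
    show "s ` D \<subseteq> tuples q n"
      by (auto simp: s_def tuples_def f_less split: if_splits)
    show "inj_on (tuple_map M n (s ` D)) (tuples p n)"
    proof (rule inj_onI)
      fix y z assume y: "y \<in> tuples p n" and z: "z \<in> tuples p n"
        and eq: "tuple_map M n (s ` D) y = tuple_map M n (s ` D) z"
      have "(\<Sum>k<n. M $$ (y k, f k (x \<inter> B k))) = (\<Sum>k<n. M $$ (z k, f k (x \<inter> B k)))"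
        if "x \<in> D" for x
        using fun_cong[OF eq, of "s x"] that by (simp add: tuple_map_def s_def)
      moreover have "y k < p" "z k < p" if "k < n" for k
        using y z that by (auto simp: tuples_def)
      ultimately have "y k = z k" if "k < n" for k
        using B by (intro down_set_decoding[OF fin \<open>finite D\<close> down _ inj f \<alpha> \<open>d \<noteq> 0\<close> inj\<alpha> range\<alpha> _ _ _ that]) auto
      then show "y = z"
        using y z unfolding tuples_def by (intro PiE_ext[of y _ _ z]) auto
    qed
  qed
  then show ?thesis
    using card_image_le[OF \<open>finite D\<close>] by blast
qed

section \<open>Counting the coordinates that a down-set can carry\<close>

text \<open>Subsets have half the full size on average; this half becomes the factor 2 of the upper
  bound.\<close>

lemma sum_card_Pow:
  assumes "finite a"
  shows "2 * (\<Sum>x\<in>Pow a. card x) = card a * 2 ^ card a"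
  using assms
proof (induction a)
  case (insert e a)
  have "(\<Sum>x\<in>Pow (insert e a). card x) = (\<Sum>x\<in>Pow a. card x) + (\<Sum>x\<in>insert e ` Pow a. card x)"
    unfolding Pow_insert using insert.hyps by (intro sum.union_disjoint) auto
  also have "(\<Sum>x\<in>insert e ` Pow a. card x) = (\<Sum>x\<in>Pow a. card (insert e x))"
    using insert.hyps by (subst sum.reindex) (auto intro!: inj_onI simp: insert_ident)
  also have "\<dots> = (\<Sum>x\<in>Pow a. card x + 1)"
    using insert.hyps by (intro sum.cong refl) (metis PowD Suc_eq_plus1 card_insert_disjoint finite_subset subsetD)
  finally have "(\<Sum>x\<in>Pow (insert e a). card x) = 2 * (\<Sum>x\<in>Pow a. card x) + 2 ^ card a"
    using insert.hyps by (simp only: sum.distrib) (simp add: card_Pow)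
  then show ?case
    using insert by (simp add: algebra_simps)
qed simp

text \<open>\<open>D\<close> is \<open>Pow {..<h}\<close> together with \<open>t\<close> copies of
  it, each marked by a fresh point. Deleting that point leads back to the unmarked copy, so
  \<open>D\<close> is downward closed, and marking only enlarges sets, so every copy contributes at
  least the sum over \<open>Pow {..<h}\<close>.\<close>

lemma exists_down_set:
  fixes \<theta> c :: real
  assumes "\<theta> \<ge> 0"
  obtains D :: "nat set set" where "finite D" "\<And>a. a \<in> D \<Longrightarrow> finite a"
    "\<And>a x. a \<in> D \<Longrightarrow> x \<subseteq> a \<Longrightarrow> x \<in> D" "card D = 2 ^ h * Suc t"
    "real (2 ^ h * Suc t) * (\<theta> * real h / 2 - c) \<le> (\<Sum>a\<in>D. \<theta> * real (card a) - c)"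
proof
  \<comment> \<open>Copy 0 is unmarked; copy \<open>i > 0\<close> has the mark \<open>h + i\<close>,
    which lies outside \<open>{..<h}\<close>.\<close>
  define j where "j = (\<lambda>(A, i). if i = 0 then A else insert (h + i) A)"
  let ?I = "Pow {..<h} \<times> {..t}"
  let ?D = "j ` ?I"
  have inj: "inj_on j ?I"
  proof (rule inj_onI)
    fix u v assume "u \<in> ?I" "v \<in> ?I" and eq: "j u = j v"
    then obtain A i B l where uv: "u = (A, i)" "v = (B, l)" "A \<subseteq> {..<h}" "B \<subseteq> {..<h}" by auto
    have "j u \<inter> {..<h} = A" "j v \<inter> {..<h} = B" "j u - {..<h} = (if i = 0 then {} else {h + i})"
      "j v - {..<h} = (if l = 0 then {} else {h + l})"
      using uv(3,4) by (auto simp: j_def uv(1,2))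
    then show "u = v"
      using eq uv(1,2) by (auto split: if_splits)
  qed
  show "finite ?D" by simp
  show fin: "finite a" if "a \<in> ?D" for a
    using that by (auto simp: j_def finite_subset)
  show "card ?D = 2 ^ h * Suc t"
    using card_image[OF inj] by (simp add: card_cartesian_product card_Pow)
  show "x \<in> ?D" if "a \<in> ?D" "x \<subseteq> a" for a x
  proof -
    obtain A i where a: "a = j (A, i)" "A \<subseteq> {..<h}" "i \<le> t" using \<open>a \<in> ?D\<close> by auto
    show ?thesis
    proof (cases "i \<noteq> 0 \<and> h + i \<in> x")
      case True
      then have "x = j (x - {h + i}, i)" "x - {h + i} \<subseteq> {..<h}"
        using a that(2) by (auto simp: j_def)
      then show ?thesis using \<open>i \<le> t\<close> by blast
    next
      case False
      then have "x = j (x, 0)" "x \<subseteq> {..<h}"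
        using a that(2) by (auto simp: j_def split: if_splits)
      then show ?thesis by blast
    qed
  qed
  have "2 * (\<Sum>A\<in>Pow {..<h}. card A) = h * 2 ^ h"
    using sum_card_Pow[of "{..<h}"] by simp
  then have "real (2 * (\<Sum>A\<in>Pow {..<h}. card A)) = real (h * 2 ^ h)"
    by (rule arg_cong)
  then have sum_card: "(\<Sum>A\<in>Pow {..<h}. real (card A)) = real h * 2 ^ h / 2"
    by simp
  have "(\<Sum>A\<in>Pow {..<h}. \<theta> * real (card A) - c) = \<theta> * (\<Sum>A\<in>Pow {..<h}. real (card A)) - 2 ^ h * c"
    by (simp add: sum_subtractf sum_distrib_left card_Pow)
  also have "\<dots> = 2 ^ h * (\<theta> * real h / 2 - c)"
    unfolding sum_card by (simp add: algebra_simps)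
  finally have sum_Pow: "(\<Sum>A\<in>Pow {..<h}. \<theta> * real (card A) - c) = 2 ^ h * (\<theta> * real h / 2 - c)" .
  have "(\<Sum>(A, i)\<in>?I. \<theta> * real (card A) - c) = real (Suc t) * (\<Sum>A\<in>Pow {..<h}. \<theta> * real (card A) - c)"
    by (subst sum.cartesian_product[symmetric], subst sum.swap) simp
  then have "real (2 ^ h * Suc t) * (\<theta> * real h / 2 - c) = (\<Sum>(A, i)\<in>?I. \<theta> * real (card A) - c)"
    unfolding sum_Pow by (simp add: algebra_simps)
  also have "\<dots> \<le> (\<Sum>u\<in>?I. \<theta> * real (card (j u)) - c)"
  proof (rule sum_mono, clarify)
    fix A i assume "A \<subseteq> {..<h}"
    then have "finite A" using finite_subset by blast
    then have "card A \<le> card (j (A, i))"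
      by (auto simp: j_def intro: card_mono)
    then show "\<theta> * real (card A) - c \<le> \<theta> * real (card (j (A, i))) - c"
      using assms by (simp add: mult_left_mono)
  qed
  also have "\<dots> = (\<Sum>a\<in>?D. \<theta> * real (card a) - c)"
    using inj by (simp add: sum.reindex)
  finally show "real (2 ^ h * Suc t) * (\<theta> * real h / 2 - c) \<le> (\<Sum>a\<in>?D. \<theta> * real (card a) - c)" .
qed

text \<open>Coordinates occupy slots \<open>(a, j)\<close>, with \<open>a\<close> the block and
  \<open>j\<close> the digit position. The bound on \<open>n\<close> says that the down-set offers
  enough slots.\<close>

lemma detecting_upper_bound:
  fixes M :: "int mat" and L :: int
  assumes M: "M \<in> carrier_mat p q" and "q > 0" and "R \<ge> 2"
    and zero: "(\<Sum>c<q. w c) = 0"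
    and L: "L = (\<Sum>c<q. max (w c) 0)" "L > 0"
    and \<alpha>: "\<And>i. i < p \<Longrightarrow> (\<Sum>c<q. w c * M $$ (i, c)) = lo + d * \<alpha> i"
    and "d \<noteq> 0" and inj\<alpha>: "inj_on \<alpha> {..<p}" and range\<alpha>: "\<And>i. i < p \<Longrightarrow> 0 \<le> \<alpha> i \<and> \<alpha> i < int R"
    and n: "real n \<le> real (2 ^ h * Suc t) * (ln 2 / ln R * real h / 2 - (ln 2 + ln L) / ln R)"
  shows "\<exists>S. detecting M n S \<and> card S \<le> 2 ^ h * Suc t"
proof -
  have lnR: "ln (real R) > 0" using \<open>R \<ge> 2\<close> by simp
  obtain D :: "nat set set" where D: "finite D" "\<And>a. a \<in> D \<Longrightarrow> finite a"
    "\<And>a x. a \<in> D \<Longrightarrow> x \<subseteq> a \<Longrightarrow> x \<in> D" "card D = 2 ^ h * Suc t"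
    and sum: "real (2 ^ h * Suc t) * (ln 2 / ln R * real h / 2 - (ln 2 + ln L) / ln R)
      \<le> (\<Sum>a\<in>D. ln 2 / ln R * real (card a) - (ln 2 + ln L) / ln R)"
    by (rule exists_down_set[of "ln 2 / ln R" h t "(ln 2 + ln L) / ln R"])
      (use lnR in \<open>auto intro!: that\<close>)
  \<comment> \<open>Solving \<open>R ^ j * L \<le> 2 ^ (card a - 1)\<close> for \<open>j\<close>
    gives \<open>j \<le> \<eta> a\<close>.\<close>
  define \<eta> where "\<eta> a = ln 2 / ln R * real (card a) - (ln 2 + ln L) / ln R" for a :: "nat set"
  \<comment> \<open>The positions from 0 to the floor of \<open>\<eta> a\<close>, hence the added 1;
    \<open>nat\<close> leaves no slot when \<open>\<eta> a\<close> is negative.\<close>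
  define \<kappa> where "\<kappa> a = nat (\<lfloor>\<eta> a\<rfloor> + 1)" for a
  define P where "P = (SIGMA a:D. {..<\<kappa> a})"
  have "\<eta> a \<le> real (\<kappa> a)" for a
    unfolding \<kappa>_def by linarith
  then have "(\<Sum>a\<in>D. \<eta> a) \<le> (\<Sum>a\<in>D. real (\<kappa> a))"
    by (intro sum_mono)
  then have "real n \<le> real (card P)"
    using n sum \<open>finite D\<close> by (simp add: P_def \<eta>_def)
  moreover have "finite P" using \<open>finite D\<close> by (simp add: P_def)
  ultimately obtain g where g: "g ` {..<n} \<subseteq> P" "inj_on g {..<n}"
    using card_le_inj[of "{..<n}" P] by auto
  have Pprop: "a \<noteq> {} \<and> int R ^ j * L \<le> 2 ^ (card a - 1)" if "(a, j) \<in> P" for a j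
  proof -
    have "j < \<kappa> a" "finite a" using that D by (auto simp: P_def)
    then have "real j \<le> \<eta> a" unfolding \<kappa>_def by linarith
    then have *: "real j * ln R + ln L \<le> (real (card a) - 1) * ln 2"
      using lnR by (simp add: \<eta>_def field_simps)
    \<comment> \<open>\<open>L\<close> is a positive integer, so \<open>ln L\<close> is not
      negative; hence a block with a slot is nonempty.\<close>
    have "real j * ln R + ln L \<ge> 0"
      using lnR L(2) by simp
    then have "real (card a) - 1 \<ge> 0"
      using * by (smt (verit) ln_gt_zero mult_neg_pos)
    then have a: "card a \<ge> 1" "a \<noteq> {}" by auto
    have "ln (real R ^ j * real_of_int L) \<le> ln (2 ^ (card a - 1))"
      using * a L(2) \<open>R \<ge> 2\<close> by (simp add: ln_mult ln_realpow of_nat_diff)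
    then have "real R ^ j * real_of_int L \<le> 2 ^ (card a - 1)"
      using L(2) \<open>R \<ge> 2\<close> by (subst (asm) ln_le_cancel_iff) auto
    then have "real_of_int (int R ^ j * L) \<le> real_of_int (2 ^ (card a - 1))" by simp
    then show ?thesis using a(2) of_int_le_iff by blast
  qed
  have "\<exists>S. detecting M n S \<and> card S \<le> card D"
  proof (rule detecting_of_down_set[OF M \<open>q > 0\<close> D(2,1,3) _ _ zero _ \<alpha> \<open>d \<noteq> 0\<close> inj\<alpha> range\<alpha>,
        where B = "\<lambda>k. fst (g k)" and e = "\<lambda>k. snd (g k)" and n = n])
    show "inj_on (\<lambda>k. (fst (g k), snd (g k))) {..<n}" using g(2) by simp
  next
    fix k assume "k < n"
    then have "(fst (g k), snd (g k)) \<in> P" using g(1) by auto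
    then show "fst (g k) \<in> D - {{}}"
      "int R ^ snd (g k) * (\<Sum>c<q. max (w c) 0) \<le> 2 ^ (card (fst (g k)) - 1)"
      using Pprop unfolding L(1)[symmetric] by (auto simp: P_def)
  qed auto
  then show ?thesis unfolding D(4) .
qed

section \<open>Separating weights and the value r(M)\<close>

lemma mult_mat_vec_eq_sum:
  assumes "M \<in> carrier_mat p q" "i < p"
  shows "(M *\<^sub>v vec q w) $ i = (\<Sum>c<q. w c * M $$ (i, c) :: int)"
  using assms by (auto simp: scalar_prod_def atLeast0LessThan mult.commute intro!: sum.cong)

text \<open>The weights are \<open>w c = t ^ c\<close> for \<open>c > 0\<close>, with \<open>t\<close> so large that a nonzero integer
  polynomial with coefficients bounded by those of \<open>M\<close> cannot vanish at \<open>t\<close>.\<close>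

lemma separating_weights_nonempty:
  fixes M :: "int mat"
  assumes M: "M \<in> carrier_mat p q"
    and rows: "\<And>i j. i < p \<Longrightarrow> j < p \<Longrightarrow> i \<noteq> j \<Longrightarrow> \<not> parallel_to_ones (row M i - row M j)"
  shows "separating_weights M \<noteq> {}"
proof -
  define m where "m = (\<Sum>i<p. \<Sum>c<q. nat \<bar>M $$ (i, c)\<bar>)"
  have bound: "\<bar>M $$ (i, c)\<bar> \<le> int m" if "i < p" "c < q" for i c
  proof -
    have "nat \<bar>M $$ (i, c)\<bar> \<le> (\<Sum>c<q. nat \<bar>M $$ (i, c)\<bar>)"
      using that by (intro member_le_sum) auto
    also have "\<dots> \<le> m"
      unfolding m_def using that by (intro member_le_sum[of i "{..<p}" "\<lambda>i. \<Sum>c<q. nat \<bar>M $$ (i, c)\<bar>"]) auto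
    finally show ?thesis by simp
  qed
  define t where "t = 4 * m + 1"
  \<comment> \<open>The entry at 0 makes the total weight 0, which replaces every \<open>a c\<close>
    by \<open>a c - a 0\<close>.\<close>
  define w where "w c = (if c = 0 then - (\<Sum>c\<in>{1..<q}. int t ^ c) else int t ^ c)" for c
  have sum_w: "(\<Sum>c<q. w c * a c) = (\<Sum>c\<in>{1..<q}. int t ^ c * (a c - a 0))" if "q > 0" for a
  proof -
    have "{..<q} = insert 0 {1..<q}" using that by auto
    then have "(\<Sum>c<q. w c * a c) = w 0 * a 0 + (\<Sum>c\<in>{1..<q}. w c * a c)" by simp
    also have "(\<Sum>c\<in>{1..<q}. w c * a c) = (\<Sum>c\<in>{1..<q}. int t ^ c * a c)"
      by (intro sum.cong) (auto simp: w_def)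
    finally show ?thesis
      by (simp add: w_def sum_distrib_right sum_subtractf right_diff_distrib)
  qed
  have "vec q w \<in> separating_weights M"
    unfolding separating_weights_def
  proof (intro CollectI conjI allI impI)
    show "vec q w \<in> carrier_vec (dim_col M)" using M by simp
    show "(\<Sum>k<dim_col M. vec q w $ k) = 0"
      using sum_w[of "\<lambda>_. 1"] M by (cases "q = 0") auto
    fix i j assume "i < dim_row M" "j < dim_row M" "i \<noteq> j"
    then have ij: "i < p" "j < p" "i \<noteq> j" using M by auto
    define \<delta> where "\<delta> c = M $$ (i, c) - M $$ (j, c)" for c
    have "\<exists>c<q. \<delta> c \<noteq> \<delta> 0"
    proof (rule ccontr)
      assume "\<not> ?thesis"
      then have const: "\<delta> c = \<delta> 0" if "c < q" for c using that by blast
      have "map_vec real_of_int (row M i - row M j)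
          = real_of_int (\<delta> 0) \<cdot>\<^sub>v vec (dim_vec (row M i - row M j)) (\<lambda>_. 1)"
        (is "?u = ?v")
      proof (rule eq_vecI)
        fix k assume "k < dim_vec ?v"
        then have "k < q" using M ij by simp
        then have "real_of_int (M $$ (i, k)) - real_of_int (M $$ (j, k)) = real_of_int (\<delta> 0)"
          using const[of k] by (simp add: \<delta>_def flip: of_int_diff)
        then show "?u $ k = ?v $ k"
          using M ij \<open>k < q\<close> by simp
      qed simp
      then show False
        using rows[OF ij] unfolding parallel_to_ones_def by blast
    qed
    then obtain c where c: "c < q" "\<delta> c \<noteq> \<delta> 0" by blast
    then have "c \<in> {1..<q}" by (cases c) auto
    have "(\<Sum>c<q. w c * \<delta> c) \<noteq> 0"
    proof
      assume "(\<Sum>c<q. w c * \<delta> c) = 0"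
      then have "(\<Sum>c\<in>{1..<q}. int t ^ c * (\<delta> c - \<delta> 0)) = 0"
        using sum_w c(1) by simp
      moreover have "\<bar>\<delta> c - \<delta> 0\<bar> < int t" if "c \<in> {1..<q}" for c
        using bound[OF ij(1), of c] bound[OF ij(2), of c] bound[OF ij(1), of 0] bound[OF ij(2), of 0] that
        by (simp add: \<delta>_def t_def)
      ultimately have "\<delta> c - \<delta> 0 = 0"
        using \<open>c \<in> {1..<q}\<close> by (intro power_digits_unique[of "{1..<q}" "\<lambda>c. c"]) auto
      then show False using c(2) by simp
    qed
    then show "(M *\<^sub>v vec q w) $ i \<noteq> (M *\<^sub>v vec q w) $ j"
      using ij mult_mat_vec_eq_sum[OF M] by (simp add: \<delta>_def sum_subtractf right_diff_distrib)
  qed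
  then show ?thesis by blast
qed

text \<open>Subtracting the minimum and dividing by the gcd turns the values into distinct integers
  \<open>\<alpha> i\<close> whose maximum is the spread ratio. They can thus serve as
  base-\<open>R\<close> digits.\<close>

lemma spread_ratio_normal_form:
  fixes M :: "int mat"
  assumes M: "M \<in> carrier_mat p q" and "p \<ge> 2" and u: "u \<in> separating_weights M"
  obtains R :: nat and lo d :: int and \<alpha> :: "nat \<Rightarrow> int" where
    "spread_ratio M u + 1 = real R" "R \<ge> 2" "d \<noteq> 0" "inj_on \<alpha> {..<p}"
    "\<And>i. i < p \<Longrightarrow> (M *\<^sub>v u) $ i = lo + d * \<alpha> i"
    "\<And>i. i < p \<Longrightarrow> 0 \<le> \<alpha> i \<and> \<alpha> i < int R"
proof -
  define v where "v i = (M *\<^sub>v u) $ i" for i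
  have dims: "dim_row M = p" using M by auto
  have v_neq: "v i \<noteq> v j" if "i < p" "j < p" "i \<noteq> j" for i j
    using u that by (auto simp: separating_weights_def v_def dims)
  define V where "V = v ` {..<p}"
  define G where "G = {v i - v j | i j. i < j \<and> j < p}"
  define d where "d = Gcd G"
  have V: "finite V" "V \<noteq> {}" using \<open>p \<ge> 2\<close> by (auto simp: V_def lessThan_empty_iff)
  have dvd: "d dvd v i - v j" if "i < p" "j < p" for i j
  proof (cases i j rule: linorder_cases)
    case less
    then show ?thesis unfolding d_def using that by (intro Gcd_dvd) (auto simp: G_def)
  next
    case greater
    then have "d dvd v j - v i" unfolding d_def using that by (intro Gcd_dvd) (auto simp: G_def)
    then show ?thesis by (metis dvd_minus_iff minus_diff_eq)
  qed simp
  have "v 0 \<noteq> v 1" using v_neq \<open>p \<ge> 2\<close> by simp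
  then have "d \<noteq> 0" using dvd[of 0 1] \<open>p \<ge> 2\<close> by auto
  moreover have "d \<ge> 0" by (simp add: d_def)
  ultimately have "d > 0" by simp
  obtain a where a: "a < p" "v a = Min V" using Min_in[OF V] by (auto simp: V_def)
  obtain b where b: "b < p" "v b = Max V" using Max_in[OF V] by (auto simp: V_def)
  define \<alpha> where "\<alpha> i = (v i - Min V) div d" for i
  have v_eq: "v i = Min V + d * \<alpha> i" if "i < p" for i
    using dvd[OF that a(1)] by (simp add: \<alpha>_def a(2))
  have range: "0 \<le> \<alpha> i \<and> \<alpha> i \<le> \<alpha> b" if "i < p" for i
  proof -
    have "Min V \<le> v i" "v i \<le> v b" using V that b(2) by (auto simp: V_def)
    then show ?thesis
      using \<open>d > 0\<close> by (auto simp: \<alpha>_def pos_imp_zdiv_nonneg_iff zdiv_mono1)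
  qed
  have inj: "inj_on \<alpha> {..<p}"
    by (rule inj_onI) (metis v_eq v_neq lessThan_iff)
  have "\<alpha> b \<noteq> 0"
  proof
    assume "\<alpha> b = 0"
    then have "\<alpha> 0 = \<alpha> 1" using range[of 0] range[of 1] \<open>p \<ge> 2\<close> by simp
    then show False using inj_onD[OF inj, of 0 1] \<open>p \<ge> 2\<close> by simp
  qed
  then have "\<alpha> b \<ge> 1" using range[OF b(1)] by simp
  have sets: "{(M *\<^sub>v u) $ i | i. i < dim_row M} = V"
    "{(M *\<^sub>v u) $ i - (M *\<^sub>v u) $ j | i j. i < j \<and> j < dim_row M} = G"
    by (auto simp: V_def G_def v_def dims simp del: index_mult_mat_vec)
  have "spread_ratio M u = real_of_int (Max V - Min V) / real_of_int d"
    unfolding spread_ratio_def sets d_def ..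
  also have "Max V - Min V = d * \<alpha> b" using v_eq[OF b(1)] b(2) by simp
  finally have "spread_ratio M u = real_of_int (\<alpha> b)" using \<open>d > 0\<close> by simp
  then have "spread_ratio M u + 1 = real (nat (\<alpha> b + 1))"
    using \<open>\<alpha> b \<ge> 1\<close> by simp
  then show thesis
    using \<open>\<alpha> b \<ge> 1\<close> \<open>d > 0\<close> inj v_eq range
    by (intro that[of "nat (\<alpha> b + 1)" d \<alpha> "Min V"]) (auto simp: v_def[symmetric] nat_le_iff)
qed

text \<open>A least element of a set of reals need not exist; here all spread ratios are natural
  numbers, so well-ordering provides one.\<close>

lemma r_value_attained:
  assumes "M \<in> carrier_mat p q" and "p \<ge> 2" and "separating_weights M \<noteq> {}"
  obtains u where "u \<in> separating_weights M" "r_value M = spread_ratio M u + 1"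
proof -
  define R where "R u = nat \<lfloor>spread_ratio M u\<rfloor>" for u
  have R: "spread_ratio M u = real (R u)" if u: "u \<in> separating_weights M" for u
  proof -
    obtain r :: nat where "spread_ratio M u + 1 = real r" "r \<ge> 2"
      using spread_ratio_normal_form[OF assms(1,2) u] by metis
    then have "spread_ratio M u = real (r - 1)" by (simp add: of_nat_diff)
    then show ?thesis by (simp add: R_def)
  qed
  obtain u where u: "u \<in> separating_weights M" "\<And>x. x \<in> separating_weights M \<Longrightarrow> R u \<le> R x"
    using ex_has_least_nat[of "\<lambda>x. x \<in> separating_weights M" _ R] assms(3) by blast
  have "(LEAST x. \<exists>w\<in>separating_weights M. x = spread_ratio M w) = spread_ratio M u"
    using u R by (intro Least_equality) auto
  then show thesis using that u(1) by (simp add: r_value_def)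
qed

section \<open>Entropy-style lower bound through weights and second moments\<close>

text \<open>Over intervals centred at \<open>c\<close> the sum is bounded by a telescoping one. With
  \<open>a = 1 + sqrt n\<close> the total is at most \<open>2 / sqrt n\<close>, the normalisation of
  one component.\<close>

lemma sum_inverse_squares_le:
  fixes a :: real and V :: "int set"
  assumes "a > 1" and "finite V"
  shows "(\<Sum>v\<in>V. 1 / (a + \<bar>real_of_int (v - c)\<bar>)\<^sup>2) \<le> 2 / (a - 1)"
proof -
  define w where "w v = 1 / (a + \<bar>real_of_int (v - c)\<bar>)\<^sup>2" for v
  have interval: "(\<Sum>v\<in>{c - int N..c + int N}. w v) \<le> 2 / (a - 1) - 2 / (a + real N)" for N
  proof (induction N)
    case 0
    have "1 / a\<^sup>2 \<le> 2 / (a * (a - 1))"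
      using \<open>a > 1\<close> by (intro frac_le) (auto simp: power2_eq_square)
    also have "\<dots> = 2 / (a - 1) - 2 / a"
      using \<open>a > 1\<close> by (simp add: field_simps)
    finally show ?case by (simp add: w_def)
  next
    case (Suc N)
    have "{c - int (Suc N)..c + int (Suc N)} =
        insert (c - int (Suc N)) (insert (c + int (Suc N)) {c - int N..c + int N})" by auto
    then have "(\<Sum>v\<in>{c - int (Suc N)..c + int (Suc N)}. w v) =
        2 / (a + real (Suc N))\<^sup>2 + (\<Sum>v\<in>{c - int N..c + int N}. w v)"
      by (simp add: w_def add_ac)
    moreover have "2 / (a + real (Suc N))\<^sup>2 \<le> 2 / ((a + real N) * (a + real (Suc N)))"
      using \<open>a > 1\<close> by (intro frac_le) (auto simp: power2_eq_square intro!: mult_mono)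
    moreover have "2 / ((a + real N) * (a + real (Suc N))) = 2 / (a + real N) - 2 / (a + real (Suc N))"
      using \<open>a > 1\<close> by (simp add: field_simps)
    ultimately show ?case using Suc by linarith
  qed
  define N where "N = (\<Sum>v\<in>V. nat \<bar>v - c\<bar>)"
  have "\<bar>v - c\<bar> \<le> int N" if "v \<in> V" for v
  proof -
    have "nat \<bar>v - c\<bar> \<le> N"
      unfolding N_def using that \<open>finite V\<close> by (intro member_le_sum) auto
    then show ?thesis by linarith
  qed
  then have "V \<subseteq> {c - int N..c + int N}" by fastforce
  then have "sum w V \<le> (\<Sum>v\<in>{c - int N..c + int N}. w v)"
    by (intro sum_mono2) (auto simp: w_def)
  also have "\<dots> \<le> 2 / (a - 1)"
    using interval[of N] \<open>a > 1\<close> by (smt (verit) divide_nonneg_nonneg of_nat_0_le_iff)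
  finally show ?thesis by (simp add: w_def)
qed

lemma finite_tuples: "finite (tuples p n)"
  unfolding tuples_def by (intro finite_PiE) auto

lemma card_tuples: "card (tuples p n) = p ^ n"
  by (simp add: tuples_def card_PiE)

lemma sum_tuples_Suc:
  "sum F (tuples p (Suc n)) = (\<Sum>i\<in>tuples p n. \<Sum>c<p. F (i(n := c)))"
proof -
  have "sum F (tuples p (Suc n)) = (\<Sum>(c, i)\<in>{..<p} \<times> tuples p n. F (i(n := c)))"
    unfolding tuples_def lessThan_Suc PiE_insert_eq
    by (subst sum.reindex[OF inj_combinator]) (auto simp: case_prod_beta)
  then show ?thesis
    by (simp add: sum.cartesian_product[symmetric] sum.swap[of _ "tuples p n"])
qed

text \<open>Variances of independent centred variables add: the cross terms vanish because each
  \<open>u k\<close> sums to 0.\<close>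

lemma second_moment_le:
  fixes u :: "nat \<Rightarrow> nat \<Rightarrow> real"
  assumes "\<And>k c. k < n \<Longrightarrow> c < p \<Longrightarrow> \<bar>u k c\<bar> \<le> U"
    and "\<And>k. k < n \<Longrightarrow> (\<Sum>c<p. u k c) = 0"
  shows "(\<Sum>i\<in>tuples p n. (\<Sum>k<n. u k (i k))\<^sup>2) \<le> real (p ^ n) * (real n * U\<^sup>2)"
  using assms
proof (induction n)
  case (Suc n)
  define X where "X i = (\<Sum>k<n. u k (i k))" for i
  have "(\<Sum>i\<in>tuples p (Suc n). (\<Sum>k<Suc n. u k (i k))\<^sup>2)
      = (\<Sum>i\<in>tuples p n. \<Sum>c<p. (X i + u n c)\<^sup>2)"
    by (simp add: sum_tuples_Suc X_def)
  also have "\<dots> = (\<Sum>i\<in>tuples p n. real p * (X i)\<^sup>2 + (\<Sum>c<p. (u n c)\<^sup>2))"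
  proof (intro sum.cong refl)
    fix i
    have "(\<Sum>c<p. (X i + u n c)\<^sup>2) = real p * (X i)\<^sup>2 + 2 * X i * (\<Sum>c<p. u n c) + (\<Sum>c<p. (u n c)\<^sup>2)"
      by (simp add: power2_sum sum.distrib sum_distrib_left mult_ac)
    then show "(\<Sum>c<p. (X i + u n c)\<^sup>2) = real p * (X i)\<^sup>2 + (\<Sum>c<p. (u n c)\<^sup>2)"
      using Suc.prems(2)[of n] by simp
  qed
  also have "\<dots> = real p * (\<Sum>i\<in>tuples p n. (X i)\<^sup>2) + real (p ^ n) * (\<Sum>c<p. (u n c)\<^sup>2)"
    by (simp add: sum.distrib sum_distrib_left card_tuples)
  also have "\<dots> \<le> real p * (real (p ^ n) * (real n * U\<^sup>2)) + real (p ^ n) * (\<Sum>c<p. U\<^sup>2)"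
  proof (intro add_mono mult_left_mono sum_mono)
    show "(\<Sum>i\<in>tuples p n. (X i)\<^sup>2) \<le> real (p ^ n) * (real n * U\<^sup>2)"
      unfolding X_def using Suc.prems by (intro Suc.IH) auto
    show "(u n c)\<^sup>2 \<le> U\<^sup>2" if "c \<in> {..<p}" for c
      using Suc.prems(1)[of n c] that by (simp add: abs_le_square_iff[symmetric])
  qed auto
  also have "\<dots> = real (p ^ Suc n) * (real (Suc n) * U\<^sup>2)"
    by (simp add: algebra_simps)
  finally show ?case .
qed simp

text \<open>Jensen's inequality for \<open>exp\<close>, from the tangent line at
  \<open>y\<close>.\<close>

lemma card_mult_exp_mean_le:
  fixes Y :: "'a \<Rightarrow> real"
  assumes "finite I" and "real (card I) * y \<le> (\<Sum>i\<in>I. Y i)"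
  shows "real (card I) * exp y \<le> (\<Sum>i\<in>I. exp (Y i))"
proof -
  have "real (card I) * exp y \<le> real (card I) * exp y + exp y * ((\<Sum>i\<in>I. Y i) - real (card I) * y)"
    using assms by simp
  also have "\<dots> = (\<Sum>i\<in>I. exp y * (1 + (Y i - y)))"
    by (simp add: sum.distrib sum_subtractf algebra_simps sum_distrib_left)
  also have "\<dots> \<le> (\<Sum>i\<in>I. exp y * exp (Y i - y))"
    by (intro sum_mono mult_left_mono exp_ge_add_one_self) auto
  also have "\<dots> = (\<Sum>i\<in>I. exp (Y i))"
    by (simp add: exp_diff)
  finally show ?thesis .
qed

text \<open>A product of probability weights concentrated at scale \<open>\<surd>n\<close> around the means sums to at most 1
  over the distinct values of the map, while the arithmetic-geometric mean inequality bounds the same sum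
  from below through the second moments.\<close>

lemma detecting_lower_bound:
  fixes M :: "int mat"
  assumes M: "M \<in> carrier_mat p q" and "p \<ge> 1" and "n \<ge> 1"
    and B: "\<And>i c. i < p \<Longrightarrow> c < q \<Longrightarrow> \<bar>real_of_int (M $$ (i, c))\<bar> \<le> B"
    and S: "detecting M n S"
  shows "real n * ln p \<le> real (card S) * (ln n / 2 + (3 * ln 2 + 8 * B\<^sup>2 + 3))"
proof -
  have dims: "dim_row M = p" "dim_col M = q" using M by auto
  have S_sub: "S \<subseteq> tuples q n" and inj: "inj_on (tuple_map M n S) (tuples p n)"
    using S by (auto simp: detecting_def dims)
  have finS: "finite S" using finite_subset[OF S_sub finite_tuples] .
  define m where "m = card S"
  define a where "a = 1 + sqrt n"
  have sqrt: "sqrt n \<ge> 1" using \<open>n \<ge> 1\<close> by simp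
  have a: "a > 1" "real n \<le> a\<^sup>2" "1 \<le> a\<^sup>2"
  proof -
    show "a > 1" "1 \<le> a\<^sup>2" using sqrt by (auto simp: a_def)
    have "(sqrt n)\<^sup>2 \<le> a\<^sup>2" using sqrt by (intro power_mono) (auto simp: a_def)
    then show "real n \<le> a\<^sup>2" by simp
  qed
  define X where "X s i = (\<Sum>k<n. M $$ (i k, s k))" for s i :: "nat \<Rightarrow> nat"
  define mean where "mean l = (\<Sum>c<p. real_of_int (M $$ (c, l))) / real p" for l
  \<comment> \<open>The centre of the weights is the mean of component \<open>s\<close>, rounded
    down to an integer.\<close>
  define c where "c s = \<lfloor>\<Sum>k<n. mean (s k)\<rfloor>" for s :: "nat \<Rightarrow> nat"
  define g where "g s v = 1 / (a + \<bar>real_of_int (v - c s)\<bar>)\<^sup>2" for s v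
  have g_pos: "g s v > 0" for s v using a(1) unfolding g_def by (intro divide_pos_pos zero_less_power) auto

  have moment: "(\<Sum>i\<in>tuples p n. - ln (g s (X s i))) \<le> real (p ^ n) * (2 * ln a + (8 * B\<^sup>2 + 3))"
    if "s \<in> S" for s
  proof -
    have s: "s k < q" if "k < n" for k using \<open>s \<in> S\<close> S_sub that by (auto simp: tuples_def)
    define u where "u k i = real_of_int (M $$ (i, s k)) - mean (s k)" for k i
    have "\<bar>mean (s k)\<bar> \<le> B" if "k < n" for k
    proof -
      have "\<bar>\<Sum>c<p. real_of_int (M $$ (c, s k))\<bar> \<le> (\<Sum>c<p. B)"
        using B s[OF that] by (intro order.trans[OF sum_abs] sum_mono) auto
      then show ?thesis using \<open>p \<ge> 1\<close> by (simp add: mean_def field_simps)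
    qed
    then have "\<bar>u k i\<bar> \<le> 2 * B" if "k < n" "i < p" for k i
      using B[OF that(2) s[OF that(1)]] that unfolding u_def by (smt (verit))
    moreover have "(\<Sum>i<p. u k i) = 0" for k
      using \<open>p \<ge> 1\<close> by (simp add: u_def sum_subtractf mean_def)
    ultimately have "(\<Sum>i\<in>tuples p n. (\<Sum>k<n. u k (i k))\<^sup>2) \<le> real (p ^ n) * (real n * (2 * B)\<^sup>2)"
      by (intro second_moment_le)
    also have "\<dots> \<le> real (p ^ n) * (a\<^sup>2 * (2 * B)\<^sup>2)"
      using a(2) by (intro mult_left_mono mult_right_mono) auto
    finally have second: "(\<Sum>i\<in>tuples p n. (\<Sum>k<n. u k (i k))\<^sup>2) \<le> real (p ^ n) * (a\<^sup>2 * (2 * B)\<^sup>2)" .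
    \<comment> \<open>Writing \<open>x\<close> for \<open>t / a\<close>, the estimates
      \<open>ln (1 + x) \<le> x\<close> and \<open>2 * x \<le> 1 + x * x\<close> replace the
      logarithm by a square, which the second moment controls.\<close>
    have "- ln (g s (X s i)) \<le> 2 * ln a + 1 + 2 * ((\<Sum>k<n. u k (i k))\<^sup>2 + a\<^sup>2) / a\<^sup>2" for i
    proof -
      define t where "t = \<bar>real_of_int (X s i - c s)\<bar>"
      have t: "t \<ge> 0" by (simp add: t_def)
      have "- ln (g s (X s i)) = 2 * ln (a + t)"
        using a(1) t unfolding g_def t_def[symmetric] by (simp add: ln_div ln_realpow)
      also have "a + t = a * (1 + t / a)" using a(1) by (simp add: field_simps)
      also have "ln \<dots> = ln a + ln (1 + t / a)"
        using a(1) t by (intro ln_mult_pos) (auto intro: add_pos_nonneg)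
      also have "ln (1 + t / a) \<le> t / a"
        using a(1) t by (intro ln_add_one_self_le_self) auto
      also have "2 * (ln a + t / a) \<le> 2 * ln a + 1 + (t / a)\<^sup>2"
        using sum_squares_ge_zero[of "t / a - 1" 0] by (simp add: power2_eq_square algebra_simps)
      also have "(t / a)\<^sup>2 = t\<^sup>2 / a\<^sup>2" by (simp add: power_divide)
      also have "t\<^sup>2 \<le> 2 * ((\<Sum>k<n. u k (i k))\<^sup>2 + 1)"
      proof -
        have "(\<Sum>k<n. u k (i k)) = X s i - (\<Sum>k<n. mean (s k))"
          by (simp add: u_def X_def sum_subtractf)
        \<comment> \<open>The rounding error of the centre, between 0 and 1.\<close>
        moreover define e where "e = (\<Sum>k<n. mean (s k)) - c s"
        ultimately have "t\<^sup>2 = ((\<Sum>k<n. u k (i k)) + e)\<^sup>2" by (simp add: t_def)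
        also have "\<dots> \<le> 2 * ((\<Sum>k<n. u k (i k))\<^sup>2 + e\<^sup>2)"
          using sum_squares_ge_zero[of "(\<Sum>k<n. u k (i k)) - e" 0]
          by (simp add: power2_eq_square algebra_simps)
        also have "e\<^sup>2 \<le> 1"
        proof -
          have "0 \<le> e" "e \<le> 1" unfolding e_def c_def by linarith+
          then show ?thesis by (simp add: power_le_one)
        qed
        finally show ?thesis by simp
      qed
      also have "2 * ((\<Sum>k<n. u k (i k))\<^sup>2 + 1) \<le> 2 * ((\<Sum>k<n. u k (i k))\<^sup>2 + a\<^sup>2)"
        using a(3) by simp
      finally show ?thesis using a(1) by (simp add: divide_right_mono)
    qed
    then have "(\<Sum>i\<in>tuples p n. - ln (g s (X s i)))
        \<le> (\<Sum>i\<in>tuples p n. 2 * ln a + 1 + 2 * ((\<Sum>k<n. u k (i k))\<^sup>2 + a\<^sup>2) / a\<^sup>2)"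
      by (rule sum_mono)
    also have "\<dots> = real (p ^ n) * (2 * ln a + 3) + 2 * (\<Sum>i\<in>tuples p n. (\<Sum>k<n. u k (i k))\<^sup>2) / a\<^sup>2"
      using a(1) by (simp add: sum.distrib card_tuples sum_divide_distrib[symmetric] sum_distrib_left[symmetric] field_simps)
    also have "\<dots> \<le> real (p ^ n) * (2 * ln a + 3) + 2 * (real (p ^ n) * (a\<^sup>2 * (2 * B)\<^sup>2)) / a\<^sup>2"
      using second by (intro add_left_mono divide_right_mono mult_left_mono) auto
    also have "\<dots> = real (p ^ n) * (2 * ln a + (8 * B\<^sup>2 + 3))"
      using a(1) by (simp add: algebra_simps)
    finally show ?thesis .
  qed

  \<comment> \<open>A lower bound for the average, over all tuples, of the logarithm of the product
    weight.\<close>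
  define y where "y = - (real m * (2 * ln a + (8 * B\<^sup>2 + 3)))"
  have "(\<Sum>i\<in>tuples p n. \<Sum>s\<in>S. - ln (g s (X s i))) \<le> (\<Sum>s\<in>S. real (p ^ n) * (2 * ln a + (8 * B\<^sup>2 + 3)))"
    by (subst sum.swap) (intro sum_mono moment)
  then have "real (card (tuples p n)) * y \<le> (\<Sum>i\<in>tuples p n. \<Sum>s\<in>S. ln (g s (X s i)))"
    by (simp add: y_def m_def card_tuples sum_negf mult_ac)
  then have "real (p ^ n) * exp y \<le> (\<Sum>i\<in>tuples p n. exp (\<Sum>s\<in>S. ln (g s (X s i))))"
    using card_mult_exp_mean_le[OF finite_tuples, of p n y] unfolding card_tuples by blast
  also have "\<dots> = (\<Sum>i\<in>tuples p n. \<Prod>s\<in>S. g s (tuple_map M n S i s))"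
    using finS g_pos by (simp add: exp_sum tuple_map_def X_def)
  \<comment> \<open>Here injectivity enters: the sum over tuples becomes a sum over distinct values,
    which is then enlarged to a full box and factorised.\<close>
  also have "\<dots> = (\<Sum>x\<in>tuple_map M n S ` tuples p n. \<Prod>s\<in>S. g s (x s))"
    using inj by (simp add: sum.reindex)
  also have "\<dots> \<le> (\<Sum>x\<in>PiE S (\<lambda>s. X s ` tuples p n). \<Prod>s\<in>S. g s (x s))"
  proof (rule sum_mono2)
    show "finite (PiE S (\<lambda>s. X s ` tuples p n))"
      using finS finite_tuples by (intro finite_PiE) auto
    show "tuple_map M n S ` tuples p n \<subseteq> PiE S (\<lambda>s. X s ` tuples p n)"
      unfolding tuple_map_def X_def[symmetric] by (intro image_subsetI restrict_PiE_iff[THEN iffD2]) blast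
    show "0 \<le> (\<Prod>s\<in>S. g s (x s))" for x
      using g_pos by (intro prod_nonneg less_imp_le)
  qed
  also have "\<dots> = (\<Prod>s\<in>S. \<Sum>v\<in>X s ` tuples p n. g s v)"
    using finS finite_tuples by (subst prod_sum_PiE) auto
  also have "\<dots> \<le> (\<Prod>s\<in>S. 2 / sqrt n)"
    using sum_inverse_squares_le[OF a(1)] finite_tuples g_pos
    by (intro prod_mono) (auto simp: g_def a_def intro!: sum_nonneg)
  finally have "real (p ^ n) * exp y \<le> (2 / sqrt n) ^ m" by (simp add: m_def)
  then have "ln (real (p ^ n) * exp y) \<le> ln ((2 / sqrt n) ^ m)"
    using \<open>p \<ge> 1\<close> \<open>n \<ge> 1\<close> by (subst ln_le_cancel_iff) auto
  then have "real n * ln p + y \<le> real m * (ln 2 - ln n / 2)"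
    using \<open>p \<ge> 1\<close> \<open>n \<ge> 1\<close> by (simp add: ln_mult_pos ln_realpow ln_div ln_sqrt)
  moreover have "a \<le> 2 * sqrt n"
    using sqrt unfolding a_def by linarith
  then have "ln a \<le> ln (2 * sqrt n)"
    using a(1) by (intro ln_mono) auto
  then have "ln a \<le> ln 2 + ln n / 2"
    using \<open>n \<ge> 1\<close> by (simp add: ln_mult_pos ln_sqrt)
  then have "real m * (2 * ln a) \<le> real m * (2 * ln 2 + ln n)"
    by (intro mult_left_mono) auto
  ultimately show ?thesis
    by (simp add: y_def m_def algebra_simps)
qed

section \<open>The choice of parameters and the asymptotics\<close>

lemma min_detecting_le:
  assumes "detecting M n S"
  shows "min_detecting M n \<le> card S"
  unfolding min_detecting_def using assms by (intro Least_le) blast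

lemma min_detecting_attained:
  assumes "detecting M n S"
  obtains T where "detecting M n T" "card T = min_detecting M n"
proof -
  have "\<exists>T. detecting M n T \<and> card T = min_detecting M n"
    unfolding min_detecting_def by (rule LeastI[of _ "card S"]) (use assms in blast)
  then show thesis using that by blast
qed

text \<open>The size \<open>2 ^ h\<close> of a copy is kept below \<open>n / (ln n)^2\<close>, so
  that rounding the number of copies up costs only a lower-order term, while \<open>h\<close> is
  still close to \<open>log 2 n\<close>.\<close>

lemma detecting_blocks_choice:
  fixes n :: nat and \<rho> \<gamma> :: real
  assumes "n \<ge> 3" and "\<rho> > 0" and "\<gamma> \<ge> 0"
    and pos: "ln n - 2 * ln (ln n) - (ln 2 + 2 * \<rho> * \<gamma>) > 0" and "ln (ln n) \<ge> 0"
  obtains h t where "real n \<le> real (2 ^ h * Suc t) * (ln 2 / \<rho> * real h / 2 - \<gamma>)"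
    "real (2 ^ h * Suc t) \<le>
       real n * (2 * \<rho> / (ln n - 2 * ln (ln n) - (ln 2 + 2 * \<rho> * \<gamma>)) + 1 / (ln n)\<^sup>2)"
proof -
  define \<Lambda> where "\<Lambda> = ln n - 2 * ln (ln n) - (ln 2 + 2 * \<rho> * \<gamma>)"
  have "\<Lambda> > 0" using pos by (simp add: \<Lambda>_def)
  have "ln n > 0" using \<open>n \<ge> 3\<close> by simp
  define x where "x = (ln n - 2 * ln (ln n)) / ln 2"
  have "0 \<le> 2 * \<rho> * \<gamma>" "ln (2 :: real) > 0" using assms by auto
  then have "ln n - 2 * ln (ln n) > 0" using pos by linarith
  then have "x \<ge> 0" by (simp add: x_def)
  define h where "h = nat \<lfloor>x\<rfloor>"
  have h: "real h \<le> x" "x - 1 < real h" using \<open>x \<ge> 0\<close> unfolding h_def by linarith+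
  \<comment> \<open>The guaranteed average number of slots per set. It is at least
    \<open>\<Lambda> / (2 * \<rho>)\<close>, where the \<open>ln 2\<close> inside
    \<open>\<Lambda>\<close> pays for rounding \<open>x\<close> down to \<open>h\<close>.\<close>
  define E where "E = ln 2 / \<rho> * real h / 2 - \<gamma>"
  have "\<Lambda> / (2 * \<rho>) \<le> E"
  proof -
    have "\<Lambda> / (2 * \<rho>) = ln 2 / \<rho> * (x - 1) / 2 - \<gamma>"
      using \<open>\<rho> > 0\<close> by (simp add: \<Lambda>_def x_def field_simps)
    also have "\<dots> \<le> E"
      unfolding E_def using h(2) \<open>\<rho> > 0\<close> by (intro diff_right_mono divide_right_mono mult_left_mono) auto
    finally show ?thesis .
  qed
  moreover have pos': "\<Lambda> / (2 * \<rho>) > 0" using \<open>\<Lambda> > 0\<close> \<open>\<rho> > 0\<close> by simp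
  ultimately have "E > 0" "n / E \<le> n / (\<Lambda> / (2 * \<rho>))"
    using divide_left_mono[of "\<Lambda> / (2 * \<rho>)" E "real n"] mult_pos_pos[of E "\<Lambda> / (2 * \<rho>)"] by linarith+
  then have E: "E > 0" "n / E \<le> real n * (2 * \<rho> / \<Lambda>)" by simp_all
  define t where "t = nat \<lfloor>n / (2 ^ h * E)\<rfloor>"
  have nonneg: "n / (2 ^ h * E) \<ge> 0" using E by simp
  have t: "real t \<le> n / (2 ^ h * E)" "n / (2 ^ h * E) \<le> real (Suc t)"
    using nonneg unfolding t_def by linarith+
  have "real n \<le> real (2 ^ h * Suc t) * E"
    using t(2) E(1) by (simp add: field_simps)
  moreover have "real (2 ^ h * Suc t) \<le> real n * (2 * \<rho> / \<Lambda> + 1 / (ln n)\<^sup>2)"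
  proof -
    have "(2::real) ^ h = exp (real h * ln 2)"
      by (metis exp_ln exp_of_nat_mult zero_less_numeral)
    also have "\<dots> \<le> exp (ln n - 2 * ln (ln n))"
      using h(1) by (simp add: x_def field_simps)
    also have "\<dots> = n / (ln n)\<^sup>2"
      using \<open>ln n > 0\<close> \<open>n \<ge> 3\<close> by (simp add: exp_diff exp_double)
    finally have pow: "(2::real) ^ h \<le> n / (ln n)\<^sup>2" .
    have "real (2 ^ h * Suc t) = 2 ^ h * real t + 2 ^ h" by (simp add: algebra_simps)
    also have "2 ^ h * real t \<le> n / E"
      using t(1) E(1) by (simp add: field_simps)
    finally show ?thesis using E(2) pow by (simp add: distrib_left)
  qed
  ultimately show thesis using that by (simp only: E_def \<Lambda>_def)
qed

text \<open>Clipping at 0 makes a one-sided estimate sufficient for membership in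
  \<open>O(w)\<close>.\<close>

lemma bigo_max_0I:
  fixes u v :: "nat \<Rightarrow> real" and w :: "nat \<Rightarrow> real"
  assumes "eventually (\<lambda>n. u n \<le> v n) at_top" and "v \<in> O(w)"
  shows "(\<lambda>n. max 0 (u n)) \<in> O(w)"
proof (rule landau_o.big.trans[OF bigoI assms(2)])
  show "eventually (\<lambda>n. norm (max 0 (u n)) \<le> 1 * norm (v n)) at_top"
    using assms(1) by eventually_elim auto
qed

theorem theorem5p3:
  fixes M :: "int mat" and p q :: nat
  assumes "M \<in> carrier_mat p q"
    and "p \<ge> 2"
    and "\<And>i j. i < p \<Longrightarrow> j < p \<Longrightarrow> i \<noteq> j \<Longrightarrow> \<not> parallel_to_ones (row M i - row M j)"
  shows "\<exists>f g :: nat \<Rightarrow> real.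
      f \<in> O(\<lambda>n. ln (ln (real n)) / ln (real n)) \<and>
      g \<in> O(\<lambda>n. ln (ln (real n)) / ln (real n)) \<and>
      (\<forall>n\<ge>2. (2 - f n) * (real n / log (real p) (real n)) \<le> real (min_detecting M n) \<and>
             real (min_detecting M n) \<le> (2 + g n) * (real n / log (r_value M) (real n)))"
proof -
  obtain u where u: "u \<in> separating_weights M" and r_value: "r_value M = spread_ratio M u + 1"
    using r_value_attained[OF assms(1,2) separating_weights_nonempty[OF assms(1,3)]] by blast
  obtain R :: nat and lo d \<alpha> where ratio: "spread_ratio M u + 1 = real R" and "R \<ge> 2" "d \<noteq> 0"
    and inj\<alpha>: "inj_on \<alpha> {..<p}" and Mu: "\<And>i. i < p \<Longrightarrow> (M *\<^sub>v u) $ i = lo + d * \<alpha> i"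
    and range\<alpha>: "\<And>i. i < p \<Longrightarrow> 0 \<le> \<alpha> i \<and> \<alpha> i < int R"
    using spread_ratio_normal_form[OF assms(1,2) u] by metis
  have R: "r_value M = real R" using r_value ratio by simp
  define w where "w c = u $ c" for c
  have u_eq: "u = vec q w"
    using u assms(1) by (intro eq_vecI) (auto simp: separating_weights_def w_def)
  have \<alpha>: "(\<Sum>c<q. w c * M $$ (i, c)) = lo + d * \<alpha> i" if "i < p" for i
    using Mu[OF that] mult_mat_vec_eq_sum[OF assms(1) that, of w] u_eq by simp
  have zero: "(\<Sum>c<q. w c) = 0"
    using u assms(1) by (simp add: separating_weights_def w_def)
  define L where "L = (\<Sum>c<q. max (w c) 0)"
  \<comment> \<open>Weights that are all nonpositive with sum 0 vanish, and then rows 0 and 1 would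
    get the same value.\<close>
  have "L \<noteq> 0"
  proof
    assume "L = 0"
    then have le: "w c \<le> 0" if "c < q" for c
      using that by (auto simp: L_def sum_nonneg_eq_0_iff max_def split: if_splits)
    then have "w c = 0" if "c < q" for c
      using that zero sum_nonneg_eq_0_iff[of "{..<q}" "\<lambda>c. - w c"] by (simp add: sum_negf)
    then have "lo + d * \<alpha> 0 = lo + d * \<alpha> 1"
      using \<alpha>[of 0, symmetric] \<alpha>[of 1, symmetric] assms(2) by simp
    then show False using inj_onD[OF inj\<alpha>, of 0 1] \<open>d \<noteq> 0\<close> assms(2) by simp
  qed
  then have "L > 0" by (simp add: L_def sum_nonneg order_less_le)
  then have "q > 0" unfolding L_def by (cases q) auto
  define \<rho> where "\<rho> = ln (real R)"
  have "\<rho> > 0" using \<open>R \<ge> 2\<close> by (simp add: \<rho>_def)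
  define \<gamma> where "\<gamma> = (ln 2 + ln L) / \<rho>"
  have "\<gamma> \<ge> 0" using \<open>L > 0\<close> \<open>\<rho> > 0\<close> by (simp add: \<gamma>_def)
  define K where "K = ln 2 + 2 * \<rho> * \<gamma>"
  have upper: "\<exists>S. detecting M n S \<and> real (card S) \<le> real n * (2 * \<rho> / (ln n - 2 * ln (ln n) - K) + 1 / (ln n)\<^sup>2)"
    if n: "n \<ge> 3" "ln n - 2 * ln (ln n) - K > 0" "ln (ln n) \<ge> 0" for n :: nat
  proof -
    obtain h t where ht: "real n \<le> real (2 ^ h * Suc t) * (ln 2 / \<rho> * real h / 2 - \<gamma>)"
      and le: "real (2 ^ h * Suc t) \<le> real n * (2 * \<rho> / (ln n - 2 * ln (ln n) - K) + 1 / (ln n)\<^sup>2)"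
      using detecting_blocks_choice[OF n(1) \<open>\<rho> > 0\<close> \<open>\<gamma> \<ge> 0\<close>] n unfolding K_def by metis
    obtain S where "detecting M n S" "card S \<le> 2 ^ h * Suc t"
      using detecting_upper_bound[OF assms(1) \<open>q > 0\<close> \<open>R \<ge> 2\<close> zero L_def \<open>L > 0\<close> \<alpha> \<open>d \<noteq> 0\<close> inj\<alpha> range\<alpha>]
        ht unfolding \<gamma>_def \<rho>_def by blast
    then show ?thesis using le by (meson of_nat_mono order.trans)
  qed
  define B where "B = (\<Sum>i<p. \<Sum>c<q. \<bar>real_of_int (M $$ (i, c))\<bar>)"
  have B: "\<bar>real_of_int (M $$ (i, c))\<bar> \<le> B" if "i < p" "c < q" for i c
  proof -
    have "\<bar>real_of_int (M $$ (i, c))\<bar> \<le> (\<Sum>c<q. \<bar>real_of_int (M $$ (i, c))\<bar>)"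
      using that by (intro member_le_sum) auto
    also have "\<dots> \<le> B"
      unfolding B_def using that
      by (intro member_le_sum[of i "{..<p}" "\<lambda>i. \<Sum>c<q. \<bar>real_of_int (M $$ (i, c))\<bar>"])
        (auto intro!: sum_nonneg)
    finally show ?thesis .
  qed
  define C where "C = 3 * ln 2 + 8 * B\<^sup>2 + 3"
  have "C > 0" by (simp add: C_def add_pos_nonneg)
  define m where "m n = real (min_detecting M n)" for n
  \<comment> \<open>\<open>f\<close> and \<open>g\<close> are the exact deviations from 2, clipped
    at 0. Both inequalities then hold for every \<open>n \<ge> 2\<close>, and only the growth of
    \<open>f\<close> and \<open>g\<close> remains to be estimated.\<close>
  define f where "f n = max 0 (2 - m n * log p n / n)" for n :: nat
  define g where "g n = max 0 (m n * log R n / n - 2)" for n :: nat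
  have large: "eventually (\<lambda>n. n \<ge> 3 \<and> ln (real n) - 2 * ln (ln (real n)) - K > 0 \<and> ln (ln (real n)) \<ge> 0) at_top"
    unfolding eventually_conj_iff by (intro conjI eventually_ge_at_top; real_asymp)
  have "f \<in> O(\<lambda>n. ln (ln (real n)) / ln (real n))"
    unfolding f_def
  proof (rule bigo_max_0I)
    show "eventually (\<lambda>n. 2 - m n * log p n / n \<le> 2 * C / (ln (real n) / 2 + C)) at_top"
      using large
    proof eventually_elim
      case (elim n)
      \<comment> \<open>Some detecting set must exist before the \<open>LEAST\<close> in
        \<open>min_detecting\<close> is known to be attained.\<close>
      obtain S where "detecting M n S" using upper elim by blast
      then obtain T where T: "detecting M n T" "card T = min_detecting M n"
        by (rule min_detecting_attained)
      have ln: "ln (real n) > 0" "ln (real p) > 0" using elim assms(2) by auto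
      have "real n * ln p \<le> m n * (ln n / 2 + C)"
        using detecting_lower_bound[OF assms(1) _ _ B T(1)] assms(2) elim
        unfolding T(2) m_def C_def by (simp add: add.assoc)
      then have "real n * ln p * (ln n / (real n * ln p)) \<le> m n * (ln n / 2 + C) * (ln n / (real n * ln p))"
        using ln by (intro mult_right_mono) auto
      then have "ln n \<le> m n * log p n / n * (ln n / 2 + C)"
        using ln elim by (simp add: log_def mult_ac)
      then have "ln n / (ln n / 2 + C) \<le> m n * log p n / n"
        using ln \<open>C > 0\<close> by (simp add: pos_divide_le_eq add_pos_pos)
      moreover have "ln n / (ln n / 2 + C) = 2 - 2 * C / (ln n / 2 + C)"
        using ln \<open>C > 0\<close> by (simp add: field_simps add_pos_pos)
      ultimately show ?case by linarith
    qed
    show "(\<lambda>n. 2 * C / (ln (real n) / 2 + C)) \<in> O(\<lambda>n. ln (ln (real n)) / ln (real n))"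
      by real_asymp
  qed
  moreover have "g \<in> O(\<lambda>n. ln (ln (real n)) / ln (real n))"
    unfolding g_def
  proof (rule bigo_max_0I)
    show "eventually (\<lambda>n. m n * log R n / n - 2 \<le>
        2 * ln (real n) / (ln (real n) - 2 * ln (ln (real n)) - K) - 2 + 1 / (ln (real n) * \<rho>)) at_top"
      using large
    proof eventually_elim
      case (elim n)
      define \<Lambda> where "\<Lambda> = ln (real n) - 2 * ln (ln (real n)) - K"
      obtain S where S: "detecting M n S" "real (card S) \<le> real n * (2 * \<rho> / \<Lambda> + 1 / (ln n)\<^sup>2)"
        using upper[of n] elim unfolding \<Lambda>_def by blast
      have ln: "ln (real n) > 0" "\<Lambda> > 0" using elim by (auto simp: \<Lambda>_def)
      have "m n \<le> real n * (2 * \<rho> / \<Lambda> + 1 / (ln n)\<^sup>2)"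
        using min_detecting_le[OF S(1)] S(2) unfolding m_def by linarith
      then have "m n * (log R n / n) \<le> real n * (2 * \<rho> / \<Lambda> + 1 / (ln n)\<^sup>2) * (log R n / n)"
        using ln \<open>\<rho> > 0\<close> by (intro mult_right_mono) (auto simp: log_def \<rho>_def[symmetric])
      also have "\<dots> = 2 * ln n / \<Lambda> + 1 / (ln n * \<rho>)"
        using ln \<open>\<rho> > 0\<close> elim by (simp add: log_def \<rho>_def[symmetric] field_simps power2_eq_square)
      finally show ?case unfolding \<Lambda>_def by simp
    qed
    \<comment> \<open>The term \<open>2 * ln (ln n)\<close> in the denominator produces the stated
      error order; the last summand, from rounding the number of copies, is smaller.\<close>
    show "(\<lambda>n. 2 * ln (real n) / (ln (real n) - 2 * ln (ln (real n)) - K) - 2 + 1 / (ln (real n) * \<rho>))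
        \<in> O(\<lambda>n. ln (ln (real n)) / ln (real n))"
      using \<open>\<rho> > 0\<close> by real_asymp
  qed
  moreover have "(2 - f n) * (real n / log p n) \<le> m n \<and> m n \<le> (2 + g n) * (real n / log R n)"
    if "n \<ge> 2" for n :: nat
  proof
    have pos: "real n > 0" "log p n > 0" "log R n > 0" using that assms(2) \<open>R \<ge> 2\<close> by auto
    have "(2 - f n) * (real n / log p n) \<le> m n * log p n / n * (real n / log p n)"
      using pos by (intro mult_right_mono) (auto simp: f_def)
    also have "\<dots> = m n" using pos by simp
    finally show "(2 - f n) * (real n / log p n) \<le> m n" .
    have "m n = m n * log R n / n * (real n / log R n)" using pos by simp
    also have "\<dots> \<le> (2 + g n) * (real n / log R n)"
      using pos by (intro mult_right_mono) (auto simp: g_def)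
    finally show "m n \<le> (2 + g n) * (real n / log R n)" .
  qed
  ultimately show ?thesis
    unfolding R m_def by blast
qed

end
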